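(* Let $X_1,\ldots,X_n$ be mutually independent real random variables on a probability space $(\Omega,\mathcal{F},\mathbb{P})$, and let $X_1',\ldots,X_n'$ be independent copies of $X_1,\ldots,X_n$ (i.e. $X_j'$ has the same distribution as $X_j$ for each $j$, and $X_1,\ldots,X_n,X_1',\ldots,X_n'$ are mutually independent). Let $F:\mathbb{R}^n\to\mathbb{H}_d$ be a bounded measurable function, where $\mathbb{H}_d$ is the space of $d\times d$ Hermitian complex matrices. Put $$\mathbf{Z}=F(X_1,\ldots,X_n)-\mathbb{E}F(X_1,\ldots,X_n),$$ $$\mathbf{Z}^{(j)}=F(X_1,\ldots,X_{j-1},X_j',X_{j+1},\ldots,X_n)-\mathbb{E}F(X_1,\ldots,X_n)\quad(1\le j\le n).$$ Then $$\mathbb{E}\left\|\mathbf{Z}\right\|_2^2\le\frac12\,\mathbb{E}\left\|\sum_{j=1}^n\left(\mathbf{Z}-\mathbf{Z}^{(j)}\right)^2\right\|_1 ,$$ where $\|\cdot\|_p$ denotes the Schatten $p$-norm on $d\times d$ matrices.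
   Context: The Schatten $p$-norm of a $d\times d$ matrix $A$ is $\|A\|_p=\left(\mathrm{tr}(|A|^p)\right)^{1/p}$ with the unnormalized trace $\mathrm{tr}$. The expectation of a random matrix is taken entrywise. *)

theory Defs
  imports "HOL-Probability.Probability"
begin

definition conj_transpose :: "complex^'n^'m \<Rightarrow> complex^'m^'n" where
  "conj_transpose A = transpose (map_matrix cnj A)"

definition hermitian_matrix :: "complex^'d^'d \<Rightarrow> bool" where
  "hermitian_matrix A \<longleftrightarrow> conj_transpose A = A"

definition unitary_matrix :: "complex^'d^'d \<Rightarrow> bool" where
  "unitary_matrix U \<longleftrightarrow> U ** conj_transpose U = mat 1 \<and> conj_transpose U ** U = mat 1"

definition real_diag :: "('d \<Rightarrow> real) \<Rightarrow> complex^'d^'d" where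
  "real_diag l = (\<chi> i j. if i = j then complex_of_real (l i) else 0)"

text \<open>
  Functional calculus: \<open>f(A) = U f(D) U\<^sup>*\<close> for a unitary diagonalization \<open>A = U D U\<^sup>*\<close> with
  real \<open>D\<close>. The result does not depend on the diagonalization (\<open>matrix_fun_eqI\<close> below),
  and one exists for every Hermitian \<open>A\<close>; for other matrices the value is unspecified.
\<close>
definition matrix_fun :: "(real \<Rightarrow> real) \<Rightarrow> complex^'d^'d \<Rightarrow> complex^'d^'d" where
  "matrix_fun f A = (THE B. \<exists>U l. unitary_matrix U
     \<and> A = U ** real_diag l ** conj_transpose U
     \<and> B = U ** real_diag (\<lambda>i. f (l i)) ** conj_transpose U)"

lemma matrix_fun_unique:
  fixes U V :: "complex^'d^'d"
  assumes U: "unitary_matrix U" and V: "unitary_matrix V"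
    and eq: "U ** real_diag l ** conj_transpose U = V ** real_diag m ** conj_transpose V"
  shows "U ** real_diag (\<lambda>i. f (l i)) ** conj_transpose U =
         V ** real_diag (\<lambda>i. f (m i)) ** conj_transpose V"
proof -
  define W where "W = conj_transpose V ** U"
  have diag_right: "(W ** real_diag h) $ i $ j = W $ i $ j * of_real (h j)" for h i j
    by (simp add: matrix_matrix_mult_def real_diag_def if_distrib[of "\<lambda>x. _ * x"] cong: if_cong)
  have diag_left: "(real_diag h ** W) $ i $ j = of_real (h i) * W $ i $ j" for h i j
    by (simp add: matrix_matrix_mult_def real_diag_def if_distrib[of "\<lambda>x. x * _"] cong: if_cong)
  have UU: "conj_transpose U ** U = mat 1" "U ** conj_transpose U = mat 1"
    and VV: "conj_transpose V ** V = mat 1" "V ** conj_transpose V = mat 1"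
    using U V by (auto simp: unitary_matrix_def)
  have cancel: "conj_transpose U ** (U ** X) = X" "U ** (conj_transpose U ** X) = X"
    "conj_transpose V ** (V ** X) = X" "V ** (conj_transpose V ** X) = X" for X :: "complex^'d^'d"
    by (simp_all add: matrix_mul_assoc UU VV)
  have "W ** real_diag l = conj_transpose V ** (U ** real_diag l ** conj_transpose U) ** U"
    unfolding W_def by (simp add: matrix_mul_assoc[symmetric] cancel UU VV)
  also have "\<dots> = real_diag m ** W"
    unfolding eq W_def by (simp add: matrix_mul_assoc[symmetric] cancel UU VV)
  finally have comm: "W $ i $ j * of_real (l j) = of_real (m i) * W $ i $ j" for i j
    using diag_right diag_left by metis
  have "W $ i $ j * of_real (f (l j)) = of_real (f (m i)) * W $ i $ j" for i j
    using comm[of i j] by (cases "W $ i $ j = 0") (auto simp: mult.commute)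
  then have fW: "W ** real_diag (\<lambda>i. f (l i)) = real_diag (\<lambda>i. f (m i)) ** W"
    by (simp add: vec_eq_iff diag_right diag_left)
  have "U ** real_diag (\<lambda>i. f (l i)) ** conj_transpose U
      = V ** (W ** real_diag (\<lambda>i. f (l i))) ** conj_transpose U"
    unfolding W_def by (simp add: matrix_mul_assoc[symmetric] cancel UU VV)
  also have "\<dots> = V ** real_diag (\<lambda>i. f (m i)) ** conj_transpose V"
    unfolding fW by (simp add: W_def matrix_mul_assoc[symmetric] cancel UU VV)
  finally show ?thesis .
qed

lemma matrix_fun_eqI:
  fixes U :: "complex^'d^'d"
  assumes "unitary_matrix U" and "A = U ** real_diag l ** conj_transpose U"
  shows "matrix_fun f A = U ** real_diag (\<lambda>i. f (l i)) ** conj_transpose U"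
  unfolding matrix_fun_def
proof (rule the_equality)
  show "\<exists>V m. unitary_matrix V \<and> A = V ** real_diag m ** conj_transpose V
     \<and> U ** real_diag (\<lambda>i. f (l i)) ** conj_transpose U =
         V ** real_diag (\<lambda>i. f (m i)) ** conj_transpose V"
    using assms by blast
next
  fix B
  assume "\<exists>V m. unitary_matrix V \<and> A = V ** real_diag m ** conj_transpose V
     \<and> B = V ** real_diag (\<lambda>i. f (m i)) ** conj_transpose V"
  then obtain V m where V: "unitary_matrix V" "A = V ** real_diag m ** conj_transpose V"
    and B: "B = V ** real_diag (\<lambda>i. f (m i)) ** conj_transpose V"
    by blast
  have "V ** real_diag m ** conj_transpose V = U ** real_diag l ** conj_transpose U"
    using V(2) assms(2) by simp
  then show "B = U ** real_diag (\<lambda>i. f (l i)) ** conj_transpose U"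
    unfolding B by (rule matrix_fun_unique[OF V(1) assms(1)])
qed

definition matrix_abs :: "complex^'d^'d \<Rightarrow> complex^'d^'d" where
  "matrix_abs A = matrix_fun sqrt (conj_transpose A ** A)"

text \<open>
  The trace of \<open>|A|\<^sup>p\<close> is real and nonnegative, so taking \<open>Re\<close> only changes the type. Since
  \<open>0 powr p = 0\<close>, the powers are the usual ones for \<open>p > 0\<close>.
\<close>
definition schatten_norm :: "real \<Rightarrow> complex^'d^'d \<Rightarrow> real" where
  "schatten_norm p A = Re (trace (matrix_fun (\<lambda>x. x powr p) (matrix_abs A))) powr (1 / p)"

definition matrix_expectation :: "'w measure \<Rightarrow> ('w \<Rightarrow> complex^'d^'d) \<Rightarrow> complex^'d^'d" where
  "matrix_expectation M Y = (\<chi> i j. \<integral>\<omega>. Y \<omega> $ i $ j \<partial>M)"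

end

theory Submission
  imports Defs begin

text \<open>
  For Hermitian matrices \<open>\<parallel>A\<parallel>\<^sub>2\<close> is the Euclidean norm on \<open>complex^'d^'d\<close>, and
  \<open>\<parallel>\<Sum>\<^sub>j D\<^sub>j\<^sup>2\<parallel>\<^sub>1 = tr (\<Sum>\<^sub>j D\<^sub>j\<^sup>2) = \<Sum>\<^sub>j \<parallel>D\<^sub>j\<parallel>\<^sub>2\<^sup>2\<close> because the sum is positive
  semidefinite. So the claim is the Efron--Stein inequality for a function with values in a
  Euclidean space. Let \<open>F\<^sub>A\<close> be \<open>F\<close> with the variables in \<open>A\<close> replaced by their copies. By
  independence the variance is \<open>E \<langle>F\<^sub>\<emptyset>, F\<^sub>\<emptyset> - F\<^sub>U\<rangle>\<close> with \<open>U\<close> the full index set, which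
  telescopes into terms \<open>E \<langle>F\<^sub>\<emptyset>, F\<^sub>A - F\<^sub>B\<rangle>\<close> with \<open>B = A \<union> {k}\<close>. Exchanging \<open>X\<^sub>k\<close> with
  \<open>X'\<^sub>k\<close> preserves the joint law and turns such a term into
  \<open>1/2 E \<langle>F\<^sub>\<emptyset> - F\<^sub>k, F\<^sub>A - F\<^sub>B\<rangle>\<close>; exchanging the variables in \<open>A\<close> shows that both factors have
  the same second moment, so Cauchy--Schwarz bounds it by \<open>1/2 E \<parallel>F\<^sub>\<emptyset> - F\<^sub>k\<parallel>\<^sup>2\<close>.
\<close>

section \<open>Spectral theorem for Hermitian matrices\<close>

text \<open>The maximum of the quadratic form on the unit sphere of \<open>S\<close> is attained at an eigenvector.\<close>
lemma self_adjoint_invariant_subspace_eigenvector: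
  fixes f :: "'a::euclidean_space \<Rightarrow> 'a"
  assumes S: "subspace S" "S \<noteq> {0}" and f: "linear f" "\<And>x. x \<in> S \<Longrightarrow> f x \<in> S"
    and self_adjoint: "\<And>x y. x \<bullet> f y = f x \<bullet> y"
  shows "\<exists>v c. v \<in> S \<and> norm v = 1 \<and> f v = c *\<^sub>R v"
proof -
  interpret linear f by (fact f(1))
  obtain s where s: "s \<in> S" "s \<noteq> 0"
    using S subspace_0 by blast
  let ?K = "sphere 0 1 \<inter> S"
  have "compact ?K"
    using closed_subspace[OF S(1)] by (intro compact_Int_closed) auto
  moreover have "(1 / norm s) *\<^sub>R s \<in> ?K"
    using s by (simp add: subspace_mul[OF S(1)])
  then have "?K \<noteq> {}"
    by blast
  moreover have "continuous_on ?K (\<lambda>x. x \<bullet> f x)"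
    using f(1) by (intro continuous_intros linear_continuous_on linear_conv_bounded_linear[THEN iffD1])
  ultimately obtain v where v: "v \<in> ?K" and max: "\<And>x. x \<in> ?K \<Longrightarrow> x \<bullet> f x \<le> v \<bullet> f v"
    using continuous_attains_sup by meson
  define c where "c = v \<bullet> f v"
  define w where "w = c *\<^sub>R v - f v"
  have vS: "v \<in> S" and nv: "norm v = 1"
    using v by auto
  have wS: "w \<in> S"
    unfolding w_def using vS f(2) S(1) by (intro subspace_diff subspace_mul)
  have form: "x \<bullet> f x \<le> c * (x \<bullet> x)" if "x \<in> S" for x
  proof (cases "x = 0")
    case False
    have "(1 / norm x) *\<^sub>R x \<in> ?K"
      using that False by (simp add: subspace_mul[OF S(1)])
    from max[OF this] have "(x \<bullet> f x) / (norm x * norm x) \<le> c"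
      by (simp add: scale c_def)
    then show ?thesis
      using False by (simp add: field_simps dot_square_norm power2_eq_square)
  qed simp
  have "f v \<bullet> v = c" "v \<bullet> v = 1"
    using nv by (simp_all add: c_def inner_commute dot_square_norm)
  then have ww: "c * (v \<bullet> w) - f v \<bullet> w = w \<bullet> w"
    by (simp add: w_def algebra_simps)
  define Q where "Q = c * (w \<bullet> w) - w \<bullet> f w"
  \<comment> \<open>First variation at the maximiser: \<open>form\<close> at
    \<open>v + t *\<^sub>R w\<close>, where the constant terms cancel because \<open>v\<close>
    attains equality.\<close>
  have quad: "0 \<le> 2 * t * (w \<bullet> w) + t\<^sup>2 * Q" for t
  proof -
    have "v + t *\<^sub>R w \<in> S"
      using vS wS S(1) by (intro subspace_add subspace_mul)
    from form[OF this] have "0 \<le> c * (v \<bullet> v) - c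
       + 2 * t * (c * (v \<bullet> w) - f v \<bullet> w) + t\<^sup>2 * (c * (w \<bullet> w) - w \<bullet> f w)"
      using self_adjoint[of v w]
      by (simp add: add scale inner_add_left inner_add_right c_def[symmetric] power2_eq_square inner_commute algebra_simps)
    then show ?thesis
      unfolding ww Q_def[symmetric] using \<open>v \<bullet> v = 1\<close> by simp
  qed
  have "w \<bullet> w = 0"
  proof (rule ccontr)
    assume "w \<bullet> w \<noteq> 0"
    then have N: "w \<bullet> w > 0"
      using inner_ge_zero[of w] by linarith
    have Q: "Q \<ge> 0"
      using form[OF wS] by (simp add: Q_def)
    \<comment> \<open>A step \<open>- t\<close> small enough for the linear term of
      \<open>quad\<close> to win; the \<open>+ 1\<close> keeps the quotient defined when
      \<open>Q = 0\<close>.\<close>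
    define t where "t = (w \<bullet> w) / (Q + 1)"
    have t: "t > 0" "t * (Q + 1) = w \<bullet> w"
      using N Q by (simp_all add: t_def)
    have "2 * (w \<bullet> w) \<le> t * Q"
      using quad[of "- t"] t(1) by (simp add: power2_eq_square)
    then show False
      using t N by (simp add: algebra_simps)
  qed
  then have "f v = c *\<^sub>R v"
    by (simp add: w_def)
  then show ?thesis
    using vS nv by blast
qed

text \<open>The Hermitian form, conjugate-linear in the first argument. The inner product
  \<open>x \<bullet> y\<close> is only its real part, and orthogonality in that weaker sense would
  not make a matrix unitary.\<close>

definition cinner :: "complex^'d \<Rightarrow> complex^'d \<Rightarrow> complex" where
  "cinner x y = (\<Sum>i\<in>UNIV. cnj (x $ i) * y $ i)"

lemma cinner_commute: "cinner y x = cnj (cinner x y)"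
  by (simp add: cinner_def mult.commute)

lemma Re_cinner: "Re (cinner x y) = x \<bullet> y"
  by (simp add: cinner_def inner_vec_def inner_complex_def)

lemma cinner_self: "cinner x x = of_real ((norm x)\<^sup>2)"
proof (rule complex_eqI)
  show "Im (cinner x x) = Im (of_real ((norm x)\<^sup>2))"
    using cinner_commute[of x x] by (simp add: complex_eq_iff)
qed (simp add: Re_cinner power2_norm_eq_inner)

lemma cinner_add_right: "cinner x (y + z) = cinner x y + cinner x z"
  by (simp add: cinner_def distrib_left sum.distrib)

lemma cinner_scaleR_right: "cinner x (c *\<^sub>R y) = c *\<^sub>R cinner x y"
  by (simp add: cinner_def scaleR_sum_right)

lemma cinner_scaleR_left: "cinner (c *\<^sub>R x) y = c *\<^sub>R cinner x y"
  by (simp add: cinner_def scaleR_sum_right)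

lemma conj_transpose_nth [simp]: "conj_transpose A $ i $ j = cnj (A $ j $ i)"
  by (simp add: conj_transpose_def transpose_def)

lemma cinner_matrix_right: "cinner x (A *v y) = cinner (conj_transpose A *v x) y"
  unfolding cinner_def matrix_vector_mult_def
  by (simp add: sum_distrib_left sum_distrib_right mult_ac) (rule sum.swap)

lemma conj_transpose_mult: "conj_transpose (A ** B) = conj_transpose B ** conj_transpose A"
  by (simp add: vec_eq_iff matrix_matrix_mult_def mult.commute)

lemma conj_transpose_conj_transpose [simp]: "conj_transpose (conj_transpose A) = A"
  by (simp add: vec_eq_iff)

lemma conj_transpose_real_diag [simp]: "conj_transpose (real_diag l) = real_diag l"
  by (simp add: vec_eq_iff real_diag_def)

text \<open>The conditions form a square homogeneous system whose row \<open>k\<close> is zero, so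
  its determinant vanishes and the kernel is nontrivial.\<close>

lemma orthogonal_vector_exists:
  fixes f :: "'d::finite \<Rightarrow> complex^'d"
  assumes "k \<notin> I"
  shows "\<exists>x. x \<noteq> 0 \<and> (\<forall>i\<in>I. cinner (f i) x = 0)"
proof -
  define B :: "complex^'d^'d" where "B = (\<chi> i j. if i \<in> I then cnj (f i $ j) else 0)"
  have "row k B = 0"
    using assms by (simp add: B_def row_def vec_eq_iff)
  then have "det B = 0"
    by (rule det_zero_row)
  then have "\<not> invertible B"
    by (simp add: invertible_det_nz)
  then obtain x where x: "x \<noteq> 0" "B *v x = 0"
    by (metis invertible_left_inverse matrix_left_invertible_ker)
  have "cinner (f i) x = 0" if "i \<in> I" for i
  proof -
    have "(B *v x) $ i = cinner (f i) x"
      using that by (simp add: B_def matrix_vector_mult_def cinner_def)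
    then show ?thesis
      using x(2) by simp
  qed
  with x(1) show ?thesis by blast
qed

text \<open>Induction on the index set: the orthogonal complement of the eigenvectors found so far
  is nonzero and invariant under \<open>A\<close>, so it contains a further unit
  eigenvector.\<close>

lemma hermitian_orthonormal_eigenvectors:
  fixes A :: "complex^'d::finite^'d"
    and I :: "'d set"
  assumes A: "hermitian_matrix A"
  shows "\<exists>f l. (\<forall>i\<in>I. A *v f i = l i *\<^sub>R f i)
           \<and> (\<forall>i\<in>I. \<forall>j\<in>I. cinner (f i) (f j) = (if i = j then 1 else 0))"
  using finite[of I]
proof (induction I rule: finite_induct)
  case (insert k I)
  from insert.IH obtain f l where eigen: "\<forall>i\<in>I. A *v f i = l i *\<^sub>R f i"
    and orth: "\<forall>i\<in>I. \<forall>j\<in>I. cinner (f i) (f j) = (if i = j then 1 else 0)"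
    by (elim exE conjE)
  have adj: "cinner x (A *v y) = cinner (A *v x) y" for x y
    using A by (simp add: cinner_matrix_right hermitian_matrix_def)
  define S where "S = {x. \<forall>i\<in>I. cinner (f i) x = 0}"
  have "subspace S"
    by (auto simp: S_def subspace_def cinner_add_right cinner_scaleR_right) (simp add: cinner_def)
  moreover have "S \<noteq> {0}"
  proof -
    obtain x where "x \<noteq> 0" "\<forall>i\<in>I. cinner (f i) x = 0"
      using orthogonal_vector_exists[OF insert.hyps(2), of f] by (elim exE conjE)
    then show ?thesis
      by (auto simp: S_def)
  qed
  moreover have "A *v x \<in> S" if "x \<in> S" for x
    using that eigen by (auto simp: S_def adj cinner_scaleR_left)
  \<comment> \<open>The eigenvector lemma works over the reals, so only the real part of the
    self-adjointness \<open>adj\<close> is passed to it; the eigenvalue it returns is real.\<close>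
  moreover have "x \<bullet> (A *v y) = (A *v x) \<bullet> y" for x y
    by (simp add: Re_cinner[symmetric] adj)
  ultimately have "\<exists>v c. v \<in> S \<and> norm v = 1 \<and> A *v v = c *\<^sub>R v"
    by (intro self_adjoint_invariant_subspace_eigenvector) auto
  then obtain v c where v: "v \<in> S" "norm v = 1" "A *v v = c *\<^sub>R v"
    by (elim exE conjE)
  have "cinner (f i) v = 0" "cinner v (f i) = 0" if "i \<in> I" for i
    using v(1) that cinner_commute[of v "f i"] by (auto simp: S_def)
  moreover have "cinner v v = 1"
    using v(2) by (simp add: cinner_self)
  ultimately show ?case
    using eigen orth v(3) insert(2)
    by (intro exI[of _ "f(k := v)"] exI[of _ "l(k := c)"]) auto
qed simp

text \<open>The eigenvectors become the columns of \<open>U\<close>. Orthonormality says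
  \<open>conj_transpose U ** U = mat 1\<close>, and a one-sided inverse of a square matrix is
  two-sided.\<close>

theorem hermitian_diagonalization:
  fixes A :: "complex^'d::finite^'d"
  assumes "hermitian_matrix A"
  obtains U l where "unitary_matrix U" "A = U ** real_diag l ** conj_transpose U"
proof -
  obtain f :: "'d \<Rightarrow> complex^'d" and l where eigen: "\<And>i. A *v f i = l i *\<^sub>R f i"
    and orth: "\<And>i j. cinner (f i) (f j) = (if i = j then 1 else 0)"
    using hermitian_orthonormal_eigenvectors[OF assms, of UNIV] by auto
  define U :: "complex^'d^'d" where "U = (\<chi> i j. f j $ i)"
  have "conj_transpose U ** U = mat 1"
    using orth by (simp add: vec_eq_iff U_def matrix_matrix_mult_def cinner_def mat_def)
  then have U: "unitary_matrix U"
    by (simp add: unitary_matrix_def matrix_left_right_inverse)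
  have "A ** U = U ** real_diag l"
  proof -
    have "(A ** U) $ i $ j = l j *\<^sub>R f j $ i" for i j
      using arg_cong[OF eigen[of j], of "\<lambda>x. x $ i"]
      by (simp add: U_def matrix_matrix_mult_def matrix_vector_mult_def)
    moreover have "(U ** real_diag l) $ i $ j = l j *\<^sub>R f j $ i" for i j
      by (simp add: U_def matrix_matrix_mult_def real_diag_def scaleR_conv_of_real
          if_distrib[of "\<lambda>x. _ * x"] mult.commute cong: if_cong)
    ultimately show ?thesis
      by (simp add: vec_eq_iff)
  qed
  then have "U ** real_diag l ** conj_transpose U = A ** (U ** conj_transpose U)"
    by (simp add: matrix_mul_assoc)
  then show ?thesis
    using that[OF U, of l] U by (simp add: unitary_matrix_def)
qed

section \<open>Schatten norms in terms of eigenvalues\<close>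

lemma trace_unitary_conj:
  assumes "unitary_matrix U"
  shows "trace (U ** B ** conj_transpose U) = trace B"
  using assms trace_mul_sym[of "U ** B" "conj_transpose U"]
  by (simp add: matrix_mul_assoc unitary_matrix_def)

lemma trace_real_diag: "trace (real_diag l) = of_real (\<Sum>i\<in>UNIV. l i)"
  by (simp add: trace_def real_diag_def)

lemma real_diag_mult: "real_diag l ** real_diag m = real_diag (\<lambda>i. l i * m i)"
  by (simp add: vec_eq_iff matrix_matrix_mult_def real_diag_def
      if_distrib[of "\<lambda>x. _ * x"] if_distrib[of "\<lambda>x. x * _"] cong: if_cong)

lemma conj_transpose_mult_diagonalized:
  fixes U :: "complex^'d::finite^'d"
  assumes U: "unitary_matrix U" and A: "A = U ** real_diag l ** conj_transpose U"
  shows "conj_transpose A ** A = U ** real_diag (\<lambda>i. l i * l i) ** conj_transpose U"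
proof -
  have "conj_transpose A ** A
      = U ** (real_diag l ** (conj_transpose U ** U) ** real_diag l) ** conj_transpose U"
    by (simp add: A conj_transpose_mult matrix_mul_assoc)
  then show ?thesis
    using U by (simp add: unitary_matrix_def real_diag_mult)
qed

text \<open>Replaces the functional calculus by eigenvalues: \<open>sqrt (l i * l i)\<close> is
  \<open>\<bar>l i\<bar>\<close>, and the trace is invariant under conjugation by
  \<open>U\<close>.\<close>

lemma schatten_norm_diagonalized:
  fixes U :: "complex^'d::finite^'d"
  assumes U: "unitary_matrix U" and A: "A = U ** real_diag l ** conj_transpose U"
  shows "schatten_norm p A = (\<Sum>i\<in>UNIV. \<bar>l i\<bar> powr p) powr (1 / p)"
proof -
  have "matrix_abs A = U ** real_diag (\<lambda>i. \<bar>l i\<bar>) ** conj_transpose U"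
    using matrix_fun_eqI[OF U conj_transpose_mult_diagonalized[OF U A], of sqrt]
    by (simp add: matrix_abs_def)
  from matrix_fun_eqI[OF U this, of "\<lambda>x. x powr p"] show ?thesis
    by (simp add: schatten_norm_def trace_unitary_conj[OF U] trace_real_diag)
qed

lemma Re_trace_conj_transpose_mult: "Re (trace (conj_transpose A ** A)) = (norm A)\<^sup>2"
proof -
  have "Re (trace (conj_transpose A ** A)) = (\<Sum>i\<in>UNIV. \<Sum>j\<in>UNIV. (norm (A $ j $ i))\<^sup>2)"
    by (simp add: trace_def matrix_matrix_mult_def cmod_def power2_eq_square)
  also have "\<dots> = (\<Sum>j\<in>UNIV. \<Sum>i\<in>UNIV. (norm (A $ j $ i))\<^sup>2)"
    by (rule sum.swap)
  also have "\<dots> = A \<bullet> A"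
    by (simp add: inner_vec_def power2_norm_eq_inner)
  finally show ?thesis
    by (simp add: power2_norm_eq_inner)
qed

text \<open>Both sides are the square root of the trace of \<open>conj_transpose A ** A\<close>,
  which is the sum of the squared eigenvalues.\<close>

lemma schatten_norm_2_hermitian:
  fixes A :: "complex^'d::finite^'d"
  assumes "hermitian_matrix A"
  shows "schatten_norm 2 A = norm A"
proof -
  obtain U l where U: "unitary_matrix U" and A: "A = U ** real_diag l ** conj_transpose U"
    using hermitian_diagonalization[OF assms] .
  have "(norm A)\<^sup>2 = (\<Sum>i\<in>UNIV. \<bar>l i\<bar> powr 2)"
    unfolding Re_trace_conj_transpose_mult[symmetric] conj_transpose_mult_diagonalized[OF U A]
    by (simp add: trace_unitary_conj[OF U] trace_real_diag power2_eq_square)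
  then show ?thesis
    unfolding schatten_norm_diagonalized[OF U A] \<open>(norm A)\<^sup>2 = _\<close>[symmetric]
    by (simp add: powr_half_sqrt)
qed

lemma schatten_norm_1_positive:
  fixes A :: "complex^'d::finite^'d"
  assumes "hermitian_matrix A" and pos: "\<And>x. 0 \<le> x \<bullet> (A *v x)"
  shows "schatten_norm 1 A = Re (trace A)"
proof -
  obtain U l where U: "unitary_matrix U" and A: "A = U ** real_diag l ** conj_transpose U"
    using hermitian_diagonalization[OF assms(1)] .
  have D: "real_diag l = conj_transpose U ** A ** U"
  proof -
    have "conj_transpose U ** A ** U
      = (conj_transpose U ** U) ** real_diag l ** (conj_transpose U ** U)"
      by (simp add: A matrix_mul_assoc)
    then show ?thesis
      using U by (simp add: unitary_matrix_def)
  qed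
  have "0 \<le> l i" for i
  proof -
    \<comment> \<open>\<open>U *v axis i 1\<close> is the eigenvector for \<open>l i\<close>, and
      the quadratic form of \<open>A\<close> takes the value \<open>l i\<close> there.\<close>
    have "l i = Re (cinner (axis i 1) (real_diag l *v axis i 1))"
      by (simp add: cinner_def matrix_vector_mult_def real_diag_def axis_def
          if_distrib[of "\<lambda>x. _ * x"] if_distrib[of cnj] if_distrib[of "\<lambda>x. x * _"] cong: if_cong)
    also have "\<dots> = (U *v axis i 1) \<bullet> (A *v (U *v axis i 1))"
      by (simp add: D cinner_matrix_right Re_cinner[symmetric] matrix_vector_mul_assoc matrix_mul_assoc conj_transpose_mult)
    finally show ?thesis
      using pos by simp
  qed
  then have "schatten_norm 1 A = (\<Sum>i\<in>UNIV. l i)"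
    by (simp add: schatten_norm_diagonalized[OF U A] sum_nonneg)
  then show ?thesis
    by (simp add: A trace_unitary_conj[OF U] trace_real_diag)
qed

text \<open>As \<open>D j\<close> is self-adjoint, \<open>x \<bullet> (D j *v (D j *v x))\<close> is
  the squared norm of \<open>D j *v x\<close>. The sum is thus positive semidefinite, and its 1-norm
  is its trace, which is additive.\<close>

lemma schatten_norm_1_sum_squares:
  fixes D :: "'n::finite \<Rightarrow> complex^'d::finite^'d"
  assumes D: "\<And>j. hermitian_matrix (D j)"
  shows "schatten_norm 1 (\<Sum>j\<in>UNIV. D j ** D j) = (\<Sum>j\<in>UNIV. (norm (D j))\<^sup>2)"
proof -
  have Dj: "conj_transpose (D j) = D j" for j
    using D by (simp add: hermitian_matrix_def)
  let ?S = "\<Sum>j\<in>UNIV. D j ** D j"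
  have "conj_transpose ?S = (\<Sum>j\<in>UNIV. conj_transpose (D j ** D j))"
    by (simp add: vec_eq_iff)
  then have "hermitian_matrix ?S"
    by (simp add: hermitian_matrix_def conj_transpose_mult Dj)
  moreover have "0 \<le> x \<bullet> (?S *v x)" for x
  proof -
    have "?S *v x = (\<Sum>j\<in>UNIV. D j *v (D j *v x))"
      unfolding matrix_vector_mul_assoc
      by (simp add: vec_eq_iff matrix_vector_mult_def sum_distrib_right) (intro allI sum.swap)
    then have "x \<bullet> (?S *v x) = (\<Sum>j\<in>UNIV. Re (cinner x (D j *v (D j *v x))))"
      by (simp add: Re_cinner inner_sum_right)
    also have "\<dots> \<ge> 0"
      by (intro sum_nonneg) (simp add: cinner_matrix_right[of x] Dj cinner_self)
    finally show ?thesis .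
  qed
  ultimately have "schatten_norm 1 ?S = Re (trace ?S)"
    by (rule schatten_norm_1_positive)
  also have "\<dots> = (\<Sum>j\<in>UNIV. Re (trace (conj_transpose (D j) ** D j)))"
    unfolding Dj by (simp add: trace_def) (rule sum.swap)
  finally show ?thesis
    by (simp only: Re_trace_conj_transpose_mult)
qed

section \<open>Independence and measurability tools\<close>

text \<open>By independence the joint law is the product of the marginals. Reindexing by
  \<open>\<sigma>\<close> permutes the factors, and \<open>eq\<close> says that the permuted factors
  are the original ones.\<close>

lemma (in prob_space) distr_permute_indep_vars:
  fixes Y :: "'i \<Rightarrow> 'a \<Rightarrow> 'b"
  assumes indep: "indep_vars (\<lambda>_. N) Y UNIV"
    and bij: "bij \<sigma>"
    and eq: "\<And>i. distr M N (Y (\<sigma> i)) = distr M N (Y i)"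
  shows "distr M (\<Pi>\<^sub>M i\<in>UNIV. N) (\<lambda>\<omega> i. Y (\<sigma> i) \<omega>) = distr M (\<Pi>\<^sub>M i\<in>UNIV. N) (\<lambda>\<omega> i. Y i \<omega>)"
proof -
  have rv [measurable]: "random_variable N (Y i)" for i
    using indep by (simp add: indep_vars_def)
  let ?P = "\<Pi>\<^sub>M i\<in>UNIV. N"
  let ?Q = "\<Pi>\<^sub>M i\<in>UNIV. distr M N (Y i)"
  have Q: "distr M ?P (\<lambda>\<omega> i. Y i \<omega>) = ?Q"
    using indep_vars_iff_distr_eq_PiM[where I = UNIV and M' = "\<lambda>_. N" and X = Y] rv indep
    by (simp add: restrict_UNIV)
  have [measurable]: "(\<lambda>\<omega> i. Y i \<omega>) \<in> measurable M ?P" "(\<lambda>w i. w (\<sigma> i)) \<in> measurable ?P ?P"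
    using measurable_space[OF rv] by (auto intro!: measurable_PiM_single' simp: space_PiM PiE_iff)
  have "distr M ?P (\<lambda>\<omega> i. Y (\<sigma> i) \<omega>) = distr (distr M ?P (\<lambda>\<omega> i. Y i \<omega>)) ?P (\<lambda>w i. w (\<sigma> i))"
    by (subst distr_distr) (auto simp: comp_def)
  also have "\<dots> = distr ?Q (\<Pi>\<^sub>M i\<in>UNIV. distr M N (Y (\<sigma> i))) (\<lambda>w. \<lambda>i\<in>UNIV. w (\<sigma> i))"
    unfolding Q by (intro distr_cong sets_PiM_cong) auto
  also have "\<dots> = (\<Pi>\<^sub>M i\<in>UNIV. distr M N (Y (\<sigma> i)))"
    using bij by (intro distr_PiM_reindex prob_space_distr rv) (auto simp: bij_def)
  also have "\<dots> = distr M ?P (\<lambda>\<omega> i. Y i \<omega>)"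
    by (simp add: eq Q)
  finally show ?thesis .
qed

text \<open>Expansion in the orthonormal \<open>Basis\<close> reduces this to the product rule for
  independent real variables.\<close>

lemma (in prob_space) indep_var_expectation_inner:
  fixes U V :: "'a \<Rightarrow> 'b::euclidean_space"
  assumes "indep_var borel U borel V" "integrable M U" "integrable M V"
  shows "expectation (\<lambda>\<omega>. U \<omega> \<bullet> V \<omega>) = expectation U \<bullet> expectation V"
proof -
  have indep: "indep_var borel (\<lambda>\<omega>. U \<omega> \<bullet> b) borel (\<lambda>\<omega>. V \<omega> \<bullet> b)" for b
    using indep_var_compose[OF assms(1), of "\<lambda>x. x \<bullet> b" borel "\<lambda>x. x \<bullet> b" borel] by (simp add: comp_def)
  have "expectation (\<lambda>\<omega>. U \<omega> \<bullet> V \<omega>) = expectation (\<lambda>\<omega>. \<Sum>b\<in>Basis. (U \<omega> \<bullet> b) * (V \<omega> \<bullet> b))"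
    by (subst euclidean_inner) simp
  also have "\<dots> = (\<Sum>b\<in>Basis. expectation (\<lambda>\<omega>. (U \<omega> \<bullet> b) * (V \<omega> \<bullet> b)))"
    using indep_var_integrable[OF indep] assms(2,3) by (intro Bochner_Integration.integral_sum) auto
  also have "\<dots> = (\<Sum>b\<in>Basis. (expectation U \<bullet> b) * (expectation V \<bullet> b))"
    using indep_var_lebesgue_integral[OF indep] assms(2,3) by simp
  also have "\<dots> = expectation U \<bullet> expectation V"
    by (rule euclidean_inner[symmetric])
  finally show ?thesis .
qed

lemma borel_measurable_vec_lambda [measurable (raw)]:
  assumes "\<And>i. (\<lambda>x. f x i) \<in> borel_measurable M"
  shows "(\<lambda>x. (\<chi> i. f x i) :: real^'n::finite) \<in> borel_measurable M"
proof (subst borel_measurable_euclidean_space, intro ballI)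
  fix b :: "real^'n" assume "b \<in> Basis"
  then obtain i where "b = axis i 1"
    by (auto simp: Basis_vec_def)
  then show "(\<lambda>x. (\<chi> i. f x i) \<bullet> b) \<in> borel_measurable M"
    using assms[of i] by (simp add: inner_axis)
qed

section \<open>Resampling and the Efron-Stein inequality in a Euclidean space\<close>

text \<open>The variables \<open>X\<^sub>i\<close> are indexed by \<open>Inl i\<close>, their copies \<open>X'\<^sub>i\<close> by \<open>Inr i\<close>.\<close>
definition swap_copies :: "'n set \<Rightarrow> 'n + 'n \<Rightarrow> 'n + 'n" where
  "swap_copies A s = (case s of Inl i \<Rightarrow> if i \<in> A then Inr i else Inl i
                              | Inr i \<Rightarrow> if i \<in> A then Inl i else Inr i)"

definition resampled :: "'n::finite set \<Rightarrow> ('n + 'n \<Rightarrow> real) \<Rightarrow> real^'n" where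
  "resampled A w = (\<chi> i. if i \<in> A then w (Inr i) else w (Inl i))"

text \<open>Reading a copy and swapping with the copy cancel when both act on a coordinate, so the
  index sets combine by symmetric difference.\<close>

lemma resampled_swap_copies:
  "resampled A (\<lambda>s. w (swap_copies B s)) = resampled ((A - B) \<union> (B - A)) w"
  by (auto simp: resampled_def swap_copies_def vec_eq_iff)

lemma bij_swap_copies: "bij (swap_copies A)"
  by (rule involuntory_imp_bij) (auto simp: swap_copies_def split: sum.split)

lemma measurable_resampled [measurable]:
  "resampled A \<in> borel_measurable (\<Pi>\<^sub>M s\<in>UNIV. borel)"
  unfolding resampled_def by measurable

text \<open>Variables and copies form one family over a sum type, so that exchanging some of them is
  a permutation of indices. Any Euclidean codomain is allowed, since the matrix structure enters
  only through the norms.\<close>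

locale resampling = prob_space M for M :: "'w measure" +
  fixes W :: "'n::finite + 'n \<Rightarrow> 'w \<Rightarrow> real"
    and F :: "real^'n \<Rightarrow> 'e::euclidean_space"
  assumes indep: "indep_vars (\<lambda>_. borel) W UNIV"
    and copies: "\<And>j. distr M borel (W (Inr j)) = distr M borel (W (Inl j))"
    and F_measurable [measurable]: "F \<in> borel_measurable borel"
    and F_bounded: "bounded (range F)"
begin

text \<open>This is \<open>F\<^sub>A\<close> of the overview: \<open>FR {}\<close> uses the original
  variables only, \<open>FR UNIV\<close> the copies only.\<close>

definition FR :: "'n set \<Rightarrow> 'w \<Rightarrow> 'e" where
  "FR A \<omega> = F (resampled A (\<lambda>s. W s \<omega>))"

lemma W_measurable [measurable]: "W s \<in> borel_measurable M"
  using indep by (simp add: indep_vars_def)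

lemma FR_measurable [measurable]: "FR A \<in> borel_measurable M"
  unfolding FR_def resampled_def by measurable

lemma FR_bounded: obtains C where "\<And>A \<omega>. norm (FR A \<omega>) \<le> C"
  using F_bounded by (auto simp: bounded_iff FR_def)

lemma FR_integrable [simp, intro]: "integrable M (FR A)"
  by (rule FR_bounded) (auto intro!: integrable_const_bound)

lemma FR_diff_integrable [simp, intro]: "integrable M (\<lambda>\<omega>. (norm (FR A \<omega> - FR B \<omega>))\<^sup>2)"
proof -
  obtain C where C: "\<And>A \<omega>. norm (FR A \<omega>) \<le> C"
    using FR_bounded by blast
  have "norm (FR A \<omega> - FR B \<omega>) \<le> C + C" for \<omega>
    using norm_triangle_le_diff[OF add_mono[OF C C]] .
  then have "(norm (FR A \<omega> - FR B \<omega>))\<^sup>2 \<le> (C + C)\<^sup>2" for \<omega>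
    by (intro power_mono) auto
  then show ?thesis
    by (intro integrable_const_bound[where B = "(C + C)\<^sup>2"]) auto
qed

lemma FR_inner_integrable [simp, intro]: "integrable M (\<lambda>\<omega>. FR A \<omega> \<bullet> FR B \<omega>)"
proof -
  obtain C where C: "\<And>A \<omega>. norm (FR A \<omega>) \<le> C"
    using FR_bounded by blast
  have "\<bar>FR A \<omega> \<bullet> FR B \<omega>\<bar> \<le> C * C" for \<omega>
    using Cauchy_Schwarz_ineq2 mult_mono[OF C C] norm_ge_zero C order_trans by meson
  then show ?thesis
    by (intro integrable_const_bound[where B = "C * C"]) auto
qed

text \<open>Exchanging the variables in \<open>C\<close> with their copies preserves the joint law.
  A two-argument \<open>h\<close> covers inner products, squared distances and, when constant in its
  second argument, means.\<close>

lemma expectation_swap: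
  assumes [measurable]: "case_prod h \<in> borel_measurable (borel \<Otimes>\<^sub>M borel)"
  shows "expectation (\<lambda>\<omega>. h (FR A \<omega>) (FR B \<omega>) :: real)
       = expectation (\<lambda>\<omega>. h (FR ((A - C) \<union> (C - A)) \<omega>) (FR ((B - C) \<union> (C - B)) \<omega>))"
proof -
  let ?P = "\<Pi>\<^sub>M s\<in>(UNIV :: ('n + 'n) set). (borel :: real measure)"
  define H where "H w = h (F (resampled A w)) (F (resampled B w))" for w
  have [measurable]: "H \<in> borel_measurable ?P"
    unfolding H_def by measurable
  have [measurable]: "(\<lambda>\<omega> s. W (\<tau> s) \<omega>) \<in> measurable M ?P" for \<tau> :: "'n + 'n \<Rightarrow> 'n + 'n"
    by (rule measurable_PiM_single') auto
  have "distr M borel (W (swap_copies C s)) = distr M borel (W s)" for s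
    by (cases s) (auto simp: swap_copies_def copies)
  then have "distr M ?P (\<lambda>\<omega> s. W (swap_copies C s) \<omega>) = distr M ?P (\<lambda>\<omega> s. W s \<omega>)"
    by (intro distr_permute_indep_vars indep bij_swap_copies)
  then have "expectation (\<lambda>\<omega>. H (\<lambda>s. W (swap_copies C s) \<omega>)) = expectation (\<lambda>\<omega>. H (\<lambda>s. W s \<omega>))"
    using integral_distr[of "\<lambda>\<omega> s. W (swap_copies C s) \<omega>" M ?P H]
      integral_distr[of "\<lambda>\<omega> s. W s \<omega>" M ?P H] by simp
  moreover have "H (\<lambda>s. W (swap_copies C s) \<omega>)
      = h (FR ((A - C) \<union> (C - A)) \<omega>) (FR ((B - C) \<union> (C - B)) \<omega>)" for \<omega>
    unfolding H_def FR_def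
    using resampled_swap_copies[of _ "\<lambda>s. W s \<omega>" C] by simp
  ultimately show ?thesis
    by (simp add: H_def FR_def)
qed

lemma expectation_inner_swap:
  "expectation (\<lambda>\<omega>. FR A \<omega> \<bullet> FR B \<omega>)
   = expectation (\<lambda>\<omega>. FR ((A - C) \<union> (C - A)) \<omega> \<bullet> FR ((B - C) \<union> (C - B)) \<omega>)"
  by (rule expectation_swap) measurable

lemma expectation_increment_le:
  assumes "k \<notin> A"
  shows "expectation (\<lambda>\<omega>. FR {} \<omega> \<bullet> FR A \<omega>) - expectation (\<lambda>\<omega>. FR {} \<omega> \<bullet> FR (insert k A) \<omega>)
       \<le> 1 / 2 * expectation (\<lambda>\<omega>. (norm (FR {} \<omega> - FR {k} \<omega>))\<^sup>2)"
proof -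
  let ?a = "\<lambda>\<omega>. FR {} \<omega> - FR {k} \<omega>" and ?b = "\<lambda>\<omega>. FR A \<omega> - FR (insert k A) \<omega>"
  have "({} - {k}) \<union> ({k} - {}) = {k}" "(A - {k}) \<union> ({k} - A) = insert k A"
    "(insert k A - {k}) \<union> ({k} - insert k A) = A"
    using assms by auto
  then have "expectation (\<lambda>\<omega>. FR {} \<omega> \<bullet> FR A \<omega>) = expectation (\<lambda>\<omega>. FR {k} \<omega> \<bullet> FR (insert k A) \<omega>)"
    "expectation (\<lambda>\<omega>. FR {} \<omega> \<bullet> FR (insert k A) \<omega>) = expectation (\<lambda>\<omega>. FR {k} \<omega> \<bullet> FR A \<omega>)"
    using expectation_inner_swap[of "{}" A "{k}"] expectation_inner_swap[of "{}" "insert k A" "{k}"]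
    by simp_all
  \<comment> \<open>Adding the two swapped expressions to the original ones gives the four terms of
    \<open>?a \<omega> \<bullet> ?b \<omega>\<close>.\<close>
  then have "2 * (expectation (\<lambda>\<omega>. FR {} \<omega> \<bullet> FR A \<omega>) - expectation (\<lambda>\<omega>. FR {} \<omega> \<bullet> FR (insert k A) \<omega>))
      = expectation (\<lambda>\<omega>. ?a \<omega> \<bullet> ?b \<omega>)"
    by (simp add: inner_diff_left inner_diff_right)
  \<comment> \<open>This pointwise form of Cauchy-Schwarz is as good as the integrated one here,
    because \<open>?a\<close> and \<open>?b\<close> have the same second moment.\<close>
  also have "\<dots> \<le> expectation (\<lambda>\<omega>. ((norm (?a \<omega>))\<^sup>2 + (norm (?b \<omega>))\<^sup>2) / 2)"
  proof (rule integral_mono)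
    show "integrable M (\<lambda>\<omega>. ?a \<omega> \<bullet> ?b \<omega>)"
      by (simp add: inner_diff_left inner_diff_right)
    show "?a \<omega> \<bullet> ?b \<omega> \<le> ((norm (?a \<omega>))\<^sup>2 + (norm (?b \<omega>))\<^sup>2) / 2" for \<omega>
      using inner_ge_zero[of "?a \<omega> - ?b \<omega>"]
      by (simp add: power2_norm_eq_inner inner_diff_left inner_diff_right inner_commute)
  qed simp
  also have "\<dots> = (expectation (\<lambda>\<omega>. (norm (?a \<omega>))\<^sup>2) + expectation (\<lambda>\<omega>. (norm (?b \<omega>))\<^sup>2)) / 2"
    by simp
  \<comment> \<open>Swapping all of \<open>A\<close> turns \<open>A\<close> into \<open>{}\<close>
    and \<open>insert k A\<close> into \<open>{k}\<close>.\<close>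
  also have "expectation (\<lambda>\<omega>. (norm (?b \<omega>))\<^sup>2) = expectation (\<lambda>\<omega>. (norm (?a \<omega>))\<^sup>2)"
  proof -
    have "(insert k A - A) \<union> (A - insert k A) = {k}"
      using assms by auto
    then show ?thesis
      using expectation_swap[of "\<lambda>x y. (norm (x - y))\<^sup>2" A "insert k A" A] by simp
  qed
  finally show ?thesis by simp
qed

text \<open>Telescoping: copies are introduced one at a time, each insertion costing at most one
  summand. For \<open>A = UNIV\<close> the left side will be the variance.\<close>

lemma expectation_resampled_le:
  "expectation (\<lambda>\<omega>. FR {} \<omega> \<bullet> FR {} \<omega>) - expectation (\<lambda>\<omega>. FR {} \<omega> \<bullet> FR A \<omega>)
   \<le> 1 / 2 * (\<Sum>k\<in>A. expectation (\<lambda>\<omega>. (norm (FR {} \<omega> - FR {k} \<omega>))\<^sup>2))"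
  using finite[of A]
proof (induction A rule: finite_induct)
  case (insert k A)
  then show ?case
    using expectation_increment_le[of k A] by (simp add: algebra_simps)
qed simp

text \<open>The two functions read disjoint blocks of the independent family, the \<open>Inl\<close>
  indices and the \<open>Inr\<close> indices.\<close>

lemma indep_FR: "indep_var borel (FR {}) borel (FR UNIV)"
proof -
  let ?L = "range Inl :: ('n + 'n) set" and ?R = "range Inr :: ('n + 'n) set"
  let ?P = "\<lambda>I. \<Pi>\<^sub>M s\<in>I. (borel :: real measure)"
  have "indep_var (?P ?L) (\<lambda>\<omega>. restrict (\<lambda>s. W s \<omega>) ?L) (?P ?R) (\<lambda>\<omega>. restrict (\<lambda>s. W s \<omega>) ?R)"
    by (rule indep_var_restrict[OF indep]) auto
  moreover have "(\<lambda>w. F (\<chi> i. w (Inl i))) \<in> borel_measurable (?P ?L)"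
    "(\<lambda>w. F (\<chi> i. w (Inr i))) \<in> borel_measurable (?P ?R)"
    by measurable
  ultimately have "indep_var borel ((\<lambda>w. F (\<chi> i. w (Inl i))) \<circ> (\<lambda>\<omega>. restrict (\<lambda>s. W s \<omega>) ?L))
      borel ((\<lambda>w. F (\<chi> i. w (Inr i))) \<circ> (\<lambda>\<omega>. restrict (\<lambda>s. W s \<omega>) ?R))"
    by (rule indep_var_compose)
  then show ?thesis
    by (simp add: comp_def FR_def[abs_def] resampled_def)
qed

text \<open>Swap all variables, testing against each fixed vector \<open>b\<close> because
  \<open>expectation_swap\<close> concerns real integrands.\<close>

lemma expectation_FR_UNIV: "expectation (FR UNIV) = expectation (FR {})"
proof -
  have "expectation (FR UNIV) \<bullet> b = expectation (FR {}) \<bullet> b" for b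
  proof -
    have "expectation (\<lambda>\<omega>. FR {} \<omega> \<bullet> b) = expectation (\<lambda>\<omega>. FR UNIV \<omega> \<bullet> b)"
      using expectation_swap[of "\<lambda>x _. x \<bullet> b" "{}" "{}" UNIV] by simp
    then show ?thesis by simp
  qed
  then show ?thesis
    by (metis vector_eq_rdot)
qed

theorem efron_stein:
  "expectation (\<lambda>\<omega>. (norm (FR {} \<omega> - expectation (FR {})))\<^sup>2)
   \<le> 1 / 2 * (\<Sum>k\<in>UNIV. expectation (\<lambda>\<omega>. (norm (FR {} \<omega> - FR {k} \<omega>))\<^sup>2))"
proof -
  define m where "m = expectation (FR {})"
  have "expectation (\<lambda>\<omega>. (norm (FR {} \<omega> - m))\<^sup>2) =
      expectation (\<lambda>\<omega>. FR {} \<omega> \<bullet> FR {} \<omega> - 2 * (FR {} \<omega> \<bullet> m) + m \<bullet> m)"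
    by (simp add: power2_norm_eq_inner inner_diff_left inner_diff_right inner_commute algebra_simps)
  also have "\<dots> = expectation (\<lambda>\<omega>. FR {} \<omega> \<bullet> FR {} \<omega>) - m \<bullet> m"
    by (simp add: prob_space m_def)
  \<comment> \<open>Independence and equal means express the squared mean as a correlation with the
    fully resampled function, which makes the variance a telescoping difference.\<close>
  also have "m \<bullet> m = expectation (\<lambda>\<omega>. FR {} \<omega> \<bullet> FR UNIV \<omega>)"
    using indep_var_expectation_inner[OF indep_FR] by (simp add: expectation_FR_UNIV m_def)
  finally show ?thesis
    using expectation_resampled_le[of UNIV] by (simp add: m_def)
qed

end

section \<open>Transfer to random Hermitian matrices\<close>

lemma hermitian_matrix_diff:
  "hermitian_matrix A \<Longrightarrow> hermitian_matrix B \<Longrightarrow> hermitian_matrix (A - B)"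
  by (simp add: hermitian_matrix_def vec_eq_iff)

text \<open>Entry projections are bounded linear, hence commute with the Bochner integral. This
  links the entrywise expectation to the vector-valued one in \<open>efron_stein\<close>.\<close>

lemma matrix_expectation_eq_integral:
  assumes "integrable M Y"
  shows "matrix_expectation M Y = integral\<^sup>L M Y"
proof -
  have "bounded_linear (\<lambda>A :: complex^'d^'d. A $ i $ j)" for i j
    by (intro bounded_linear_compose[OF bounded_linear_vec_nth] bounded_linear_vec_nth)
  from integral_bounded_linear[OF this assms] show ?thesis
    by (simp add: matrix_expectation_def vec_eq_iff)
qed

lemma hermitian_matrix_expectation:
  assumes "\<And>\<omega>. hermitian_matrix (Y \<omega>)"
  shows "hermitian_matrix (matrix_expectation M Y)"
proof -
  have "cnj (Y \<omega> $ j $ i) = Y \<omega> $ i $ j" for \<omega> i j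
    using assms[of \<omega>] by (metis conj_transpose_nth hermitian_matrix_def)
  then have "cnj (\<integral>\<omega>. Y \<omega> $ j $ i \<partial>M) = (\<integral>\<omega>. Y \<omega> $ i $ j \<partial>M)" for i j
    using Bochner_Integration.integral_cnj[of M "\<lambda>\<omega>. Y \<omega> $ j $ i"] by simp
  then show ?thesis
    by (simp add: hermitian_matrix_def matrix_expectation_def vec_eq_iff)
qed

theorem corollary3p2:
  fixes M :: "'w measure"
    and X X' :: "'n::finite \<Rightarrow> 'w \<Rightarrow> real"
    and F :: "real^'n \<Rightarrow> complex^'d^'d"
    and Z :: "'w \<Rightarrow> complex^'d^'d"
    and Zr :: "'n \<Rightarrow> 'w \<Rightarrow> complex^'d^'d"
  assumes "prob_space M"
    and indep: "prob_space.indep_vars M (\<lambda>_. borel) (case_sum X X') (UNIV :: ('n + 'n) set)"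
    and copies: "\<And>j. distr M borel (X' j) = distr M borel (X j)"
    and F_measurable: "F \<in> borel_measurable borel"
    and F_bounded: "bounded (range F)"
    and F_hermitian: "\<And>x. hermitian_matrix (F x)"
  defines "Z \<equiv> \<lambda>\<omega>. F (\<chi> i. X i \<omega>) - matrix_expectation M (\<lambda>\<omega>. F (\<chi> i. X i \<omega>))"
    and "Zr \<equiv> \<lambda>j \<omega>. F (\<chi> i. if i = j then X' j \<omega> else X i \<omega>)
                     - matrix_expectation M (\<lambda>\<omega>. F (\<chi> i. X i \<omega>))"
  shows "(\<integral>\<omega>. (schatten_norm 2 (Z \<omega>))\<^sup>2 \<partial>M)
       \<le> 1 / 2 * (\<integral>\<omega>. schatten_norm 1 (\<Sum>j\<in>UNIV. (Z \<omega> - Zr j \<omega>) ** (Z \<omega> - Zr j \<omega>)) \<partial>M)"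
proof -
  interpret prob_space M by fact
  interpret resampling M "case_sum X X'" F
    by unfold_locales (use indep copies F_measurable F_bounded in auto)
  have F0: "F (\<chi> i. X i \<omega>) = FR {} \<omega>" for \<omega>
    by (simp add: FR_def resampled_def)
  have F1: "F (\<chi> i. if i = j then X' j \<omega> else X i \<omega>) = FR {j} \<omega>" for j \<omega>
    unfolding FR_def resampled_def by (rule arg_cong[of _ _ F]) (simp add: vec_eq_iff)
  have Z: "Z \<omega> = FR {} \<omega> - expectation (FR {})" for \<omega>
    by (simp add: Z_def F0 matrix_expectation_eq_integral)
  have diff: "Z \<omega> - Zr j \<omega> = FR {} \<omega> - FR {j} \<omega>" for j \<omega>
    by (simp add: Z_def Zr_def F0 F1)
  have herm: "hermitian_matrix (FR A \<omega>)" for A \<omega>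
    by (simp add: FR_def F_hermitian)
  have "hermitian_matrix (Z \<omega>)" for \<omega>
    unfolding Z_def by (intro hermitian_matrix_diff hermitian_matrix_expectation F_hermitian)
  then have "(\<integral>\<omega>. (schatten_norm 2 (Z \<omega>))\<^sup>2 \<partial>M)
      = expectation (\<lambda>\<omega>. (norm (FR {} \<omega> - expectation (FR {})))\<^sup>2)"
    by (simp add: schatten_norm_2_hermitian Z)
  also have "\<dots> \<le> 1 / 2 * (\<Sum>j\<in>UNIV. expectation (\<lambda>\<omega>. (norm (FR {} \<omega> - FR {j} \<omega>))\<^sup>2))"
    by (rule efron_stein)
  \<comment> \<open>The differences are Hermitian, so the 1-norm is pointwise a finite sum of
    squared norms, which is integrated term by term.\<close>
  also have "\<dots> = 1 / 2 * (\<integral>\<omega>. schatten_norm 1 (\<Sum>j\<in>UNIV. (Z \<omega> - Zr j \<omega>) ** (Z \<omega> - Zr j \<omega>)) \<partial>M)"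
    by (simp add: diff schatten_norm_1_sum_squares hermitian_matrix_diff herm)
  finally show ?thesis .
qed

end
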